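(* For any $d\in\mathbb{N}$ and $a\in\mathbb{N}_0$, $$t^{\star}(\{\{2\}^a,3,\{2\}^a,1\}^{d-1},\{2\}^a,3,\{2\}^a)=-\frac{2}{\pi}\sum_{r=1}^{2d}2^r\sum_{\substack{s_1+\cdots+s_r=2d\\ s_1,\ldots,s_r\geq1}}t\big((2a+2)s_1,\ldots,(2a+2)s_r;\,(-1)^{s_1},\ldots,(-1)^{s_{r-1}},(-1)^{s_r-1}\big),$$ where for $r=1$ the inner sum is the single value $t(\overline{2d(2a+2)})$.
   Context: $t^{\star}(\boldsymbol{s})=\sum_{k_1\geq\cdots\geq k_r\geq1}\prod_{j}(2k_j-1)^{-s_j}$ for an index with $s_1>1$; $\{\boldsymbol{u}\}^m$ denotes the sequence $\boldsymbol{u}$ concatenated $m$ times (empty if $m=0$). Alternating multiple $t$-values: for $\boldsymbol{s}\in\mathbb{N}^r$, $\boldsymbol{\sigma}\in\{\pm1\}^r$ with $(s_1,\sigma_1)\ne(1,1)$, $t(\boldsymbol{s};\boldsymbol{\sigma})=\sum_{k_1>\cdots>k_r\geq1}\prod_{j}\frac{\sigma_j^{k_j}}{(2k_j-1)^{s_j}}$; a bar over an argument means its sign is $-1$, so $t(\overline{m})=\sum_{k\ge1}(-1)^k(2k-1)^{-m}$. *)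

theory Defs
  imports Complex_Main
begin

fun tstar_trunc :: "nat \<Rightarrow> nat list \<Rightarrow> real" where
  "tstar_trunc N [] = 1"
| "tstar_trunc N (s # ss) =
     (\<Sum>k = 1..N. (1 / (2 * real k - 1) ^ s) * tstar_trunc k ss)"

definition tstar :: "nat list \<Rightarrow> real" where
  "tstar ss = lim (\<lambda>N. tstar_trunc N ss)"

text \<open>Truncated alternating multiple t-sum: sum over N >= k_1 > ... > k_r >= 1
  of prod_j sigma_j^k_j / (2 k_j - 1)^s_j.  Arguments are pairs (s_j, sigma_j)
  with sigma_j in {1,-1}.\<close>
fun talt_trunc :: "nat \<Rightarrow> (nat \<times> int) list \<Rightarrow> real" where
  "talt_trunc N [] = 1"
| "talt_trunc N ((s, \<sigma>) # ss) =
     (\<Sum>k = 1..N. (real_of_int \<sigma> ^ k / (2 * real k - 1) ^ s) * talt_trunc (k - 1) ss)"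

definition talt :: "nat list \<Rightarrow> int list \<Rightarrow> real" where
  "talt ss \<sigma>s = lim (\<lambda>N. talt_trunc N (zip ss \<sigma>s))"

definition sign_vec :: "nat list \<Rightarrow> int list" where
  "sign_vec ss = map (\<lambda>x. (-1) ^ x) (butlast ss) @ [(-1) ^ (last ss - 1)]"

definition compositions :: "nat \<Rightarrow> nat \<Rightarrow> nat list set" where
  "compositions n r = {ss. length ss = r \<and> (\<forall>x\<in>set ss. 1 \<le> x) \<and> sum_list ss = n}"

end

theory Submission
  imports Defs "HOL-Analysis.Analysis"
begin

text \<open>
  Write \<open>T\<^sub>s f (n) = \<Sum>k=1..n. f k / (2k-1)^s\<close>. The operator \<open>T\<^sub>2\<close> is triangular with eigenvalues
  \<open>1 / (2k-1)\<^sup>2\<close>; its eigenvectors \<open>n \<mapsto> U(n,k)\<close>, normalised to \<open>U(n,k) \<longlonglongrightarrow> 4/\<pi>\<close>, are the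
  multiples \<open>4 \<Gamma>(n+1/2)\<^sup>2 / (\<pi> (n-k)! (n+k-1)!)\<close>. The constant \<open>1\<close> has coordinates
  \<open>(-1)^(k-1) / (2k-1)\<close> in this basis, and multiplication by \<open>(2n-1)\<close> or its inverse, hence also \<open>T\<^sub>1\<close>
  and \<open>T\<^sub>3\<close>, has a simple matrix whose off-diagonal part is (up to signs) twice strict summation.
  So the coordinates of the truncated star sum are \<open>-L^(2d-1) x\<close> with \<open>x\<^sub>k = (2k-1)^(-2a-2)\<close> and
  \<open>L f (j) = (-1)^j x\<^sub>j (f j + 2 \<Sum>k<j. f k)\<close>. Choosing \<open>f j\<close> or \<open>2 \<Sum>k<j. f k\<close> in each of the
  \<open>2d-1\<close> factors enumerates the compositions of \<open>2d\<close>, and dominated convergence gives the limit.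
\<close>

section \<open>Eigenvectors of \<open>T\<^sub>2\<close> and their recurrences\<close>

abbreviation odd_of :: "nat \<Rightarrow> real" where
  "odd_of k \<equiv> 2 * real k - 1"

lemma double_real_neq_one [simp]: "2 * real k \<noteq> 1"
proof
  assume "2 * real k = 1"
  then have "real (2 * k) = real 1" by simp
  then have "2 * k = 1" by (simp only: of_nat_eq_iff)
  then show False by presburger
qed

lemma odd_of_nonzero: "odd_of k \<noteq> 0"
  by simp

text \<open>The products encode \<open>U(n,k)\<close> so that it vanishes for \<open>k > n\<close> without a case distinction.\<close>

definition eigvec :: "nat \<Rightarrow> nat \<Rightarrow> real" where
  "eigvec n k = 4 * real n * (\<Prod>i=1..n. (odd_of i / (2 * real i))\<^sup>2)
                 * (\<Prod>i=1..<k. (real n - real i) / (real n + real i))"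

text \<open>The product gains exactly one factor. This recurrence in \<open>k\<close> drives all
  telescoping sums below; \<open>k \<ge> 1\<close> keeps \<open>n + k\<close> nonzero.\<close>

lemma eigvec_Suc_right:
  assumes "1 \<le> k"
  shows "(real n + real k) * eigvec n (Suc k) = (real n - real k) * eigvec n k"
  using assms by (simp add: eigvec_def)

text \<open>The factor \<open>i = n\<close> of the product vanishes, and for \<open>n = 0\<close>
  the prefactor does. This triangularity removes the upper boundary terms later.\<close>

lemma eigvec_eq_0: "n < k \<Longrightarrow> eigvec n k = 0"
proof (cases "n = 0")
  case False
  assume "n < k"
  with False have "(\<Prod>i=1..<k. (real n - real i) / (real n + real i)) = 0"
    by (intro prod_zero) (auto intro!: bexI[of _ n])
  then show ?thesis by (simp add: eigvec_def)
qed (simp add: eigvec_def)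

text \<open>The ratio in \<open>n\<close> of the Gamma quotient, free of division so that it also
  covers \<open>m < k\<close>. Induction on \<open>k\<close> reduces it to
  \<open>k = 1\<close>.\<close>

lemma eigvec_Suc_left:
  assumes "1 \<le> k"
  shows "4 * (real m + 1 - real k) * (real m + real k) * eigvec (Suc m) k = (2 * real m + 1)\<^sup>2 * eigvec m k"
  using assms
proof (induction k rule: dec_induct)
  case base
  define P where "P = (\<Prod>i=1..m. (odd_of i / (2 * real i))\<^sup>2)"
  have Psuc: "(\<Prod>i=1..Suc m. (odd_of i / (2 * real i))\<^sup>2) = P * ((2 * real m + 1) / (2 * (real m + 1)))\<^sup>2"
    by (simp add: P_def algebra_simps)
  have "4 * x * (x + 1) * (4 * (x + 1) * (P * ((2 * x + 1) / (2 * (x + 1)))\<^sup>2))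
      = (2 * x + 1)\<^sup>2 * (4 * x * P)" if "x \<ge> 0" for x :: real
  proof -
    have "4 * (x + 1) * (x + 1) = (2 * (x + 1))\<^sup>2" by (simp add: power2_eq_square algebra_simps)
    moreover have "2 * (x + 1) \<noteq> 0" using that by simp
    ultimately have "((2 * x + 1) / (2 * (x + 1)))\<^sup>2 * (4 * (x + 1) * (x + 1)) = (2 * x + 1)\<^sup>2"
      by (simp add: power_divide del: distrib_left_numeral)
    then have "4 * x * P * (((2 * x + 1) / (2 * (x + 1)))\<^sup>2 * (4 * (x + 1) * (x + 1))) = 4 * x * P * (2 * x + 1)\<^sup>2"
      by (simp only:)
    then show ?thesis by (simp only: mult_ac)
  qed
  from this[of "real m"]
  have "4 * real m * (real m + 1) * (4 * (real m + 1) * (P * ((2 * real m + 1) / (2 * (real m + 1)))\<^sup>2))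
      = (2 * real m + 1)\<^sup>2 * (4 * real m * P)" by simp
  moreover have "4 * (real m + 1 - real 1) * (real m + real 1) * eigvec (Suc m) 1
      = 4 * real m * (real m + 1) * (4 * (real m + 1) * (P * ((2 * real m + 1) / (2 * (real m + 1)))\<^sup>2))"
    unfolding eigvec_def Psuc by (simp add: add.commute)
  moreover have "eigvec m 1 = 4 * real m * P" by (simp add: eigvec_def P_def)
  ultimately show ?case by (simp only:)
next
  case (step k)
  have 1: "(real m + 1 + real k) * eigvec (Suc m) (Suc k) = (real m + 1 - real k) * eigvec (Suc m) k"
    using eigvec_Suc_right[of k "Suc m"] step by (simp add: algebra_simps)
  have 2: "(real m + real k) * eigvec m (Suc k) = (real m - real k) * eigvec m k"
    using eigvec_Suc_right[of k m] step by simp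
  \<comment> \<open>The nonzero multiplier \<open>m + k\<close> lets the recurrence in
    \<open>k\<close> apply at both \<open>m\<close> and \<open>Suc m\<close>; it is cancelled at the
    end.\<close>
  have "(real m + real k) * (4 * (real m - real k) * ((real m + 1 + real k) * eigvec (Suc m) (Suc k)))
     = (real m - real k) * (4 * (real m + 1 - real k) * (real m + real k) * eigvec (Suc m) k)"
    unfolding 1 by (simp only: mult_ac)
  also have "\<dots> = (2 * real m + 1)\<^sup>2 * ((real m - real k) * eigvec m k)"
    unfolding step by (simp add: mult_ac)
  also have "\<dots> = (real m + real k) * ((2 * real m + 1)\<^sup>2 * eigvec m (Suc k))"
    unfolding 2[symmetric] by (simp add: mult_ac)
  finally have "4 * (real m - real k) * ((real m + 1 + real k) * eigvec (Suc m) (Suc k))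
     = (2 * real m + 1)\<^sup>2 * eigvec m (Suc k)"
    using step by simp
  then show ?case by (simp add: algebra_simps)
qed

text \<open>Difference form of the eigenvector equation: it is the recurrence in \<open>m\<close>,
  because \<open>4 (m+1-k) (m+k) = (2m+1)^2 - (2k-1)^2\<close>.\<close>

lemma eigvec_diff:
  assumes "1 \<le> k"
  shows "(eigvec (Suc m) k - eigvec m k) / (odd_of k)\<^sup>2 = eigvec (Suc m) k / (odd_of (Suc m))\<^sup>2"
proof -
  have "(odd_of (Suc m))\<^sup>2 * (eigvec (Suc m) k - eigvec m k) = (odd_of k)\<^sup>2 * eigvec (Suc m) k"
    using eigvec_Suc_left[OF assms, of m] by (simp add: algebra_simps power2_eq_square)
  moreover have "odd_of (Suc m) \<noteq> 0" "odd_of k \<noteq> 0" by (rule odd_of_nonzero)+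
  ultimately show ?thesis by (simp add: frac_eq_eq mult.commute del: of_nat_Suc)
qed

section \<open>Coordinates in the eigenvector basis\<close>

lemma sum_telescope_down:
  fixes G :: "nat \<Rightarrow> real"
  assumes "\<And>k. 1 \<le> k \<Longrightarrow> f k = G k - G (Suc k)"
  shows "(\<Sum>k=1..n. f k) = G 1 - G (Suc n)"
  by (induction n) (simp_all add: assms)

text \<open>Index 0 is left out because every eigenvector vanishes there, whereas the star sum of
  the empty list is 1.\<close>

definition expands :: "(nat \<Rightarrow> real) \<Rightarrow> (nat \<Rightarrow> real) \<Rightarrow> bool" where
  "expands e f \<longleftrightarrow> (\<forall>n\<ge>1. f n = (\<Sum>k=1..n. e k * eigvec n k))"

text \<open>Gosper summation in \<open>k\<close>, after multiplication by \<open>n - 1\<close>;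
  hence \<open>n \<ge> 2\<close>.\<close>

lemma sum_alternating_odd_eigvec:
  assumes "2 \<le> n"
  shows "(\<Sum>k=1..n. (-1) ^ k * odd_of k * eigvec n k) = 0"
proof -
  \<comment> \<open>Zero at \<open>k = 1\<close> through the factor \<open>k - 1\<close>, and at
    \<open>k = n + 1\<close> through the eigenvector.\<close>
  define G where "G k = (-1) ^ k * ((real k - 1) * (real n + real k - 1) * eigvec n k)" for k
  have "(real n - 1) * (\<Sum>k=1..n. (-1) ^ k * odd_of k * eigvec n k)
      = (\<Sum>k=1..n. (real n - 1) * ((-1) ^ k * odd_of k * eigvec n k))"
    by (simp only: sum_distrib_left)
  also have "\<dots> = G 1 - G (Suc n)"
  proof (rule sum_telescope_down)
    fix k :: nat assume k: "1 \<le> k"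
    have "G k - G (Suc k) = (-1) ^ k * ((real k - 1) * (real n + real k - 1) * eigvec n k
        + real k * ((real n + real k) * eigvec n (Suc k)))"
      by (simp add: G_def algebra_simps)
    also have "\<dots> = (real n - 1) * ((-1) ^ k * odd_of k * eigvec n k)"
      unfolding eigvec_Suc_right[OF k] by (simp add: algebra_simps)
    finally show "(real n - 1) * ((-1) ^ k * odd_of k * eigvec n k) = G k - G (Suc k)" ..
  qed
  also have "\<dots> = 0" by (simp add: G_def eigvec_eq_0)
  finally show ?thesis using assms by simp
qed

text \<open>By \<open>eigvec_diff\<close>, raising \<open>n\<close> changes the sum by a multiple of
  the alternating sum just shown to vanish; at \<open>n = 1\<close> it is
  \<open>eigvec 1 1 = 1\<close>.\<close>

lemma expands_one: "expands (\<lambda>k. (-1) ^ (k - 1) / odd_of k) (\<lambda>n. 1)"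
  unfolding expands_def
proof (intro allI impI)
  fix n :: nat assume "1 \<le> n"
  then show "1 = (\<Sum>k=1..n. (-1) ^ (k - 1) / odd_of k * eigvec n k)"
  proof (induction n rule: dec_induct)
    case base
    show ?case by (simp add: eigvec_def power2_eq_square)
  next
    case (step n)
    have "(\<Sum>k=1..Suc n. (-1) ^ (k - 1) / odd_of k * eigvec (Suc n) k)
        - (\<Sum>k=1..Suc n. (-1) ^ (k - 1) / odd_of k * eigvec n k)
        = (\<Sum>k=1..Suc n. (-1) ^ (k - 1) * odd_of k * ((eigvec (Suc n) k - eigvec n k) / (odd_of k)\<^sup>2))"
      unfolding sum_subtractf[symmetric]
      by (intro sum.cong refl) (simp add: field_simps power2_eq_square)
    also have "\<dots> = (\<Sum>k=1..Suc n. - (1 / (odd_of (Suc n))\<^sup>2) * ((-1) ^ k * odd_of k * eigvec (Suc n) k))"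
    proof (intro sum.cong refl)
      fix k assume "k \<in> {1..Suc n}"
      then have k: "1 \<le> k" by simp
      then have "(-1 :: real) ^ k = - ((-1) ^ (k - 1))" by (cases k) auto
      then show "(-1) ^ (k - 1) * odd_of k * ((eigvec (Suc n) k - eigvec n k) / (odd_of k)\<^sup>2)
         = - (1 / (odd_of (Suc n))\<^sup>2) * ((-1) ^ k * odd_of k * eigvec (Suc n) k)"
        unfolding eigvec_diff[OF k] by simp
    qed
    also have "\<dots> = 0"
      unfolding sum_distrib_left[symmetric] using sum_alternating_odd_eigvec[of "Suc n"] step
      by simp
    finally show ?case using step by (simp add: eigvec_eq_0)
  qed
qed

text \<open>\<open>T\<^sub>2\<close> acts diagonally: by \<open>eigvec_diff\<close>, both sides have
  the same increment in \<open>n\<close>.\<close>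

lemma expands_sum_square:
  assumes "expands e f"
  shows "expands (\<lambda>k. e k / (odd_of k)\<^sup>2) (\<lambda>n. \<Sum>k=1..n. 1 / (odd_of k)\<^sup>2 * f k)"
  unfolding expands_def
proof (intro allI impI)
  fix n :: nat
  show "(\<Sum>k=1..n. 1 / (odd_of k)\<^sup>2 * f k) = (\<Sum>k=1..n. e k / (odd_of k)\<^sup>2 * eigvec n k)"
  proof (induction n)
    case (Suc n)
    have "1 / (odd_of (Suc n))\<^sup>2 * f (Suc n)
        = (\<Sum>k=1..Suc n. e k * (eigvec (Suc n) k / (odd_of (Suc n))\<^sup>2))"
      using assms by (simp add: expands_def sum_divide_distrib del: sum.cl_ivl_Suc)
    also have "\<dots> = (\<Sum>k=1..Suc n. e k * ((eigvec (Suc n) k - eigvec n k) / (odd_of k)\<^sup>2))"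
      by (intro sum.cong refl) (simp add: eigvec_diff del: of_nat_Suc)
    also have "\<dots> = (\<Sum>k=1..Suc n. e k / (odd_of k)\<^sup>2 * eigvec (Suc n) k)
                   - (\<Sum>k=1..Suc n. e k / (odd_of k)\<^sup>2 * eigvec n k)"
      unfolding sum_subtractf[symmetric] by (intro sum.cong refl) (simp add: field_simps)
    finally have "1 / (odd_of (Suc n))\<^sup>2 * f (Suc n)
        = (\<Sum>k=1..Suc n. e k / (odd_of k)\<^sup>2 * eigvec (Suc n) k)
           - (\<Sum>k=1..n. e k / (odd_of k)\<^sup>2 * eigvec n k)"
      by (simp add: eigvec_eq_0)
    then show ?case using Suc by simp
  qed simp
qed

text \<open>Summation by parts. The alternating signs make the recurrence weights add up,
  \<open>(n+j-1) + (n-j) = 2n-1\<close>, which cancels the denominator.\<close>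

lemma expands_divide:
  assumes "expands e f"
  defines "h \<equiv> \<lambda>k. (-1) ^ k * e k / odd_of k"
  shows "expands (\<lambda>j. (-1) ^ j * (h j + 2 * (\<Sum>k=1..<j. h k))) (\<lambda>n. f n / odd_of n)"
  unfolding expands_def
proof (intro allI impI)
  fix n :: nat assume n: "1 \<le> n"
  define s where "s j = (\<Sum>k=1..<j. h k)" for j
  \<comment> \<open>The boundary terms vanish: \<open>s 1\<close> is an empty sum and
    \<open>eigvec n (Suc n) = 0\<close>.\<close>
  define G where "G j = 2 / odd_of n * (-1) ^ j * (s j * ((real n + real j - 1) * eigvec n j))" for j
  have "(\<Sum>j=1..n. (-1) ^ j * (h j + 2 * s j) * eigvec n j - e j / odd_of n * eigvec n j) = G 1 - G (Suc n)"
  proof (rule sum_telescope_down)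
    fix j :: nat assume j: "1 \<le> j"
    have e: "e j = (-1) ^ j * odd_of j * h j"
      by (simp add: h_def flip: power_add mult.assoc)
    have s: "s (Suc j) = s j + h j" using j by (simp add: s_def)
    have "G j - G (Suc j) = 2 / odd_of n * (-1) ^ j *
        (s j * ((real n + real j - 1) * eigvec n j) + s (Suc j) * ((real n + real j) * eigvec n (Suc j)))"
      by (simp add: G_def algebra_simps)
    also have "\<dots> = 2 / odd_of n * (-1) ^ j *
        (s j * ((real n + real j - 1) * eigvec n j) + (s j + h j) * ((real n - real j) * eigvec n j))"
      unfolding eigvec_Suc_right[OF j] s ..
    also have "\<dots> = (-1) ^ j * (h j + 2 * s j) * eigvec n j - e j / odd_of n * eigvec n j"
    proof -
      define z :: real where "z = (-1) ^ j"
      show ?thesis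
        unfolding e z_def[symmetric] using odd_of_nonzero[of n]
        by (simp add: divide_simps) (simp add: algebra_simps)
    qed
    finally show "(-1) ^ j * (h j + 2 * s j) * eigvec n j - e j / odd_of n * eigvec n j = G j - G (Suc j)" ..
  qed
  also have "\<dots> = 0" by (simp add: G_def eigvec_eq_0 s_def)
  finally have "(\<Sum>j=1..n. e j / odd_of n * eigvec n j) = (\<Sum>j=1..n. (-1) ^ j * (h j + 2 * s j) * eigvec n j)"
    by (simp add: sum_subtractf)
  moreover have "f n / odd_of n = (\<Sum>j=1..n. e j / odd_of n * eigvec n j)"
    using assms n by (simp add: expands_def sum_divide_distrib)
  ultimately show "f n / odd_of n = (\<Sum>j=1..n. (-1) ^ j * (h j + 2 * (\<Sum>k=1..<j. h k)) * eigvec n j)"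
    by (simp add: s_def)
qed

text \<open>As for division but without signs, so the weights subtract:
  \<open>(n+j-1) - (n-j) = 2j-1\<close>, the factor in the new coordinates.\<close>

lemma expands_mult:
  assumes "expands e f"
  shows "expands (\<lambda>j. odd_of j * (e j + 2 * (\<Sum>k=1..<j. e k))) (\<lambda>n. odd_of n * f n)"
  unfolding expands_def
proof (intro allI impI)
  fix n :: nat assume n: "1 \<le> n"
  define s where "s j = (\<Sum>k=1..<j. e k)" for j
  define G where "G j = 2 * (s j * ((real n + real j - 1) * eigvec n j))" for j
  have "(\<Sum>j=1..n. odd_of j * (e j + 2 * s j) * eigvec n j - odd_of n * (e j * eigvec n j)) = G 1 - G (Suc n)"
  proof (rule sum_telescope_down)
    fix j :: nat assume j: "1 \<le> j"
    have s: "s (Suc j) = s j + e j" using j by (simp add: s_def)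
    have "G j - G (Suc j) = 2 *
        (s j * ((real n + real j - 1) * eigvec n j) - s (Suc j) * ((real n + real j) * eigvec n (Suc j)))"
      by (simp add: G_def algebra_simps)
    also have "\<dots> = odd_of j * (e j + 2 * s j) * eigvec n j - odd_of n * (e j * eigvec n j)"
      unfolding eigvec_Suc_right[OF j] s by (simp add: algebra_simps)
    finally show "odd_of j * (e j + 2 * s j) * eigvec n j - odd_of n * (e j * eigvec n j) = G j - G (Suc j)" ..
  qed
  also have "\<dots> = 0" by (simp add: G_def eigvec_eq_0 s_def)
  finally have "odd_of n * (\<Sum>j=1..n. e j * eigvec n j) = (\<Sum>j=1..n. odd_of j * (e j + 2 * s j) * eigvec n j)"
    by (simp add: sum_subtractf sum_distrib_left)
  then show "odd_of n * f n = (\<Sum>j=1..n. odd_of j * (e j + 2 * (\<Sum>k=1..<j. e k)) * eigvec n j)"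
    using assms n by (simp add: s_def expands_def)
qed

section \<open>Coordinates of truncated star sums\<close>

lemma expands_tstar_twos:
  assumes "expands e (\<lambda>n. tstar_trunc n ss)"
  shows "expands (\<lambda>k. e k / odd_of k ^ (2 * a)) (\<lambda>n. tstar_trunc n (replicate a 2 @ ss))"
proof (induction a)
  case (Suc a)
  have "(\<lambda>k. e k / odd_of k ^ (2 * Suc a)) = (\<lambda>k. e k / odd_of k ^ (2 * a) / (odd_of k)\<^sup>2)"
    by (simp add: power2_eq_square mult_ac)
  with expands_sum_square[OF Suc] show ?case by (simp only: replicate_Suc append_Cons tstar_trunc.simps)
qed (use assms in simp)

text \<open>\<open>T\<^sub>3\<close> is division by \<open>2n-1\<close> followed by
  \<open>T\<^sub>2\<close>.\<close>

lemma expands_tstar_three: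
  assumes "expands e (\<lambda>n. tstar_trunc n ss)"
  defines "h \<equiv> \<lambda>k. (-1) ^ k * e k / odd_of k"
  shows "expands (\<lambda>j. (-1) ^ j * (h j + 2 * (\<Sum>k=1..<j. h k)) / (odd_of j)\<^sup>2) (\<lambda>n. tstar_trunc n (3 # ss))"
proof -
  have "1 / (odd_of k)\<^sup>2 * (tstar_trunc k ss / odd_of k) = 1 / odd_of k ^ 3 * tstar_trunc k ss" for k
    by (simp add: power2_eq_square power3_eq_cube)
  with expands_sum_square[OF expands_divide[OF assms(1)]] show ?thesis
    by (simp only: h_def tstar_trunc.simps)
qed

text \<open>\<open>T\<^sub>1\<close> is multiplication by \<open>2n-1\<close> followed by
  \<open>T\<^sub>2\<close>.\<close>

lemma expands_tstar_one:
  assumes "expands e (\<lambda>n. tstar_trunc n ss)"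
  shows "expands (\<lambda>j. (e j + 2 * (\<Sum>k=1..<j. e k)) / odd_of j) (\<lambda>n. tstar_trunc n (1 # ss))"
proof -
  have "1 / (odd_of k)\<^sup>2 * (odd_of k * tstar_trunc k ss) = 1 / odd_of k ^ 1 * tstar_trunc k ss" for k
    by (simp add: power2_eq_square)
  moreover have "odd_of j * (e j + 2 * (\<Sum>k=1..<j. e k)) / (odd_of j)\<^sup>2
    = (e j + 2 * (\<Sum>k=1..<j. e k)) / odd_of j" for j
    by (simp add: power2_eq_square)
  ultimately show ?thesis
    using expands_sum_square[OF expands_mult[OF assms(1)]] by simp
qed

text \<open>The operator \<open>L\<close>, with \<open>b = 2a+2\<close>.\<close>

definition altop :: "nat \<Rightarrow> (nat \<Rightarrow> real) \<Rightarrow> nat \<Rightarrow> real" where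
  "altop b f j = (-1) ^ j / odd_of j ^ b * (f j + 2 * (\<Sum>k=1..<j. f k))"

text \<open>At positive indices \<open>altop\<close> reads only positive indices. The start vector
  is identified only there: at 0 its exponent \<open>k - 1\<close> truncates.\<close>

lemma expands_altop_cong:
  assumes "expands (altop b g) f" "\<And>k. 1 \<le> k \<Longrightarrow> g k = h k"
  shows "expands (altop b h) f"
proof -
  have "altop b g k = altop b h k" if "1 \<le> k" for k
    using that assms(2) by (simp add: altop_def)
  with assms(1) show ?thesis by (simp add: expands_def)
qed

text \<open>The exponent \<open>2a+2\<close> collects \<open>2a\<close> from the twos and 2 from the
  \<open>T\<^sub>2\<close> inside the 3. The factor \<open>(-1)^k / (2k-1)\<close> stays in the
  argument, to merge with what lies inside.\<close>

lemma expands_tstar_block: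
  assumes "expands e (\<lambda>n. tstar_trunc n ss)"
  shows "expands (altop (2 * a + 2) (\<lambda>k. (-1) ^ k * e k / odd_of k))
           (\<lambda>n. tstar_trunc n (replicate a 2 @ [3] @ ss))"
proof -
  have "altop (2 * a + 2) (\<lambda>k. (-1) ^ k * e k / odd_of k) =
     (\<lambda>j. (-1) ^ j * ((-1) ^ j * e j / odd_of j + 2 * (\<Sum>k=1..<j. (-1) ^ k * e k / odd_of k))
       / (odd_of j)\<^sup>2 / odd_of j ^ (2 * a))"
    by (rule ext) (simp add: altop_def power_add power2_eq_square mult.commute)
  then show ?thesis
    using expands_tstar_twos[OF expands_tstar_three[OF assms], of a] by simp
qed

text \<open>Each stretch \<open>{2}^a, 3\<close> contributes one \<open>altop\<close>, and so does
  each \<open>{2}^a, 1\<close>; the tail adds one more, which makes \<open>2m+1\<close>.\<close>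

lemma expands_tstar_blocks:
  "expands ((altop (2 * a + 2) ^^ (2 * m + 1)) (\<lambda>k. - (1 / odd_of k ^ (2 * a + 2))))
     (\<lambda>n. tstar_trunc n (concat (replicate m (replicate a 2 @ [3] @ replicate a 2 @ [1]))
                 @ replicate a 2 @ [3] @ replicate a 2))"
proof (induction m)
  case 0
  have "expands (\<lambda>k. (-1) ^ (k - 1) / odd_of k) (\<lambda>n. tstar_trunc n [])"
    using expands_one by simp
  from expands_tstar_block[OF expands_tstar_twos[OF this, of a], of a]
  have "expands (altop (2 * a + 2) (\<lambda>k. (-1) ^ k * ((-1) ^ (k - 1) / odd_of k / odd_of k ^ (2 * a)) / odd_of k))
      (\<lambda>n. tstar_trunc n (replicate a 2 @ [3] @ replicate a 2))" (is "expands (altop _ ?h) _")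
    by simp
  \<comment> \<open>The innermost signs \<open>(-1)^k\<close> and \<open>(-1)^(k-1)\<close> combine
    to -1, the source of the overall minus sign.\<close>
  moreover have "?h k = - (1 / odd_of k ^ (2 * a + 2))" if "1 \<le> k" for k
  proof -
    have "(-1) ^ k * (-1) ^ (k - 1) = (-1 :: real)" using that
      by (cases k) (simp_all flip: power_add)
    then have "(-1) ^ k * ((-1) ^ (k - 1) / y / z) / y = - (1 / (z * y\<^sup>2))" for y z :: real
      by (simp add: power2_eq_square mult.commute)
    from this[of "odd_of k" "odd_of k ^ (2 * a)"] show ?thesis by (simp only: power_add)
  qed
  ultimately have "expands (altop (2 * a + 2) (\<lambda>k. - (1 / odd_of k ^ (2 * a + 2))))
      (\<lambda>n. tstar_trunc n (replicate a 2 @ [3] @ replicate a 2))"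
    by (rule expands_altop_cong)
  then show ?case by simp
next
  case (Suc m)
  define e where "e = (altop (2 * a + 2) ^^ (2 * m + 1)) (\<lambda>k. - (1 / odd_of k ^ (2 * a + 2)))"
  define w :: "nat list" where "w = concat (replicate m (replicate a 2 @ [3] @ replicate a 2 @ [1]))
                 @ replicate a 2 @ [3] @ replicate a 2"
  have "expands e (\<lambda>n. tstar_trunc n w)" using Suc by (simp add: e_def w_def)
  from expands_tstar_block[OF expands_tstar_twos[OF expands_tstar_one[OF this], of a], of a]
  have 1: "expands (altop (2 * a + 2) (\<lambda>k. (-1) ^ k * ((e k + 2 * (\<Sum>i=1..<k. e i)) / odd_of k / odd_of k ^ (2 * a)) / odd_of k))
      (\<lambda>n. tstar_trunc n (replicate a 2 @ [3] @ replicate a 2 @ 1 # w))" (is "expands (altop _ ?h) _")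
    by simp
  \<comment> \<open>The twos and the 1, with the sign and denominator pending from the outer 3, form
    exactly another \<open>altop\<close>.\<close>
  have 2: "?h = altop (2 * a + 2) e"
    by (rule ext) (simp add: altop_def power_add power2_eq_square mult.commute)
  have 3: "(altop (2 * a + 2) ^^ (2 * Suc m + 1)) (\<lambda>k. - (1 / odd_of k ^ (2 * a + 2)))
      = altop (2 * a + 2) (altop (2 * a + 2) e)"
    by (simp add: e_def)
  show ?case using 1 unfolding 2 3 by (simp add: w_def)
qed


section \<open>Limits of eigenvectors and of expansions\<close>

text \<open>The squared product times \<open>2n+1\<close> is the reciprocal of the Wallis product,
  so the limit will be \<open>4 * (1/2) / (pi/2) = 4/pi\<close>.\<close>

lemma eigvec_1_wallis:
  "eigvec n 1 = 4 * (real n / (2 * real n + 1)) / (\<Prod>k=1..n. (4 * (real k)\<^sup>2) / (4 * (real k)\<^sup>2 - 1))"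
proof -
  have "(\<Prod>i=1..n. (odd_of i / (2 * real i))\<^sup>2) * (2 * real n + 1)
      * (\<Prod>k=1..n. (4 * (real k)\<^sup>2) / (4 * (real k)\<^sup>2 - 1)) = 1"
  proof (induction n)
    case (Suc n)
    define x where "x = real (Suc n)"
    have x: "x \<ge> 1" "real n = x - 1" by (simp_all add: x_def)
    have step: "((2 * x - 1) / (2 * x))\<^sup>2 * (2 * x + 1) * (4 * x\<^sup>2 / (4 * x\<^sup>2 - 1)) = 2 * x - 1"
    proof -
      have "4 * x\<^sup>2 - 1 = (2 * x - 1) * (2 * x + 1)" by (simp add: algebra_simps power2_eq_square)
      moreover have "2 * x - 1 \<noteq> 0" "2 * x + 1 \<noteq> 0" "x \<noteq> 0" using x by auto
      ultimately show ?thesis by (simp add: power_divide power_mult_distrib) (simp add: power2_eq_square)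
    qed
    define P where "P = (\<Prod>i=1..n. (odd_of i / (2 * real i))\<^sup>2)"
    define Q where "Q = (\<Prod>k=1..n. (4 * (real k)\<^sup>2) / (4 * (real k)\<^sup>2 - 1))"
    have "(P * ((2 * x - 1) / (2 * x))\<^sup>2) * (2 * x + 1) * (Q * (4 * x\<^sup>2 / (4 * x\<^sup>2 - 1)))
        = P * (((2 * x - 1) / (2 * x))\<^sup>2 * (2 * x + 1) * (4 * x\<^sup>2 / (4 * x\<^sup>2 - 1))) * Q"
      by (simp only: mult_ac)
    also have "\<dots> = 1"
      unfolding step using Suc x by (simp add: P_def Q_def algebra_simps)
    finally have "(P * ((2 * x - 1) / (2 * x))\<^sup>2) * (2 * x + 1) * (Q * (4 * x\<^sup>2 / (4 * x\<^sup>2 - 1))) = 1" .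
    moreover have "(\<Prod>i=1..Suc n. (odd_of i / (2 * real i))\<^sup>2) = P * ((2 * x - 1) / (2 * x))\<^sup>2"
      by (simp add: P_def x_def)
    moreover have "(\<Prod>k=1..Suc n. (4 * (real k)\<^sup>2) / (4 * (real k)\<^sup>2 - 1)) = Q * (4 * x\<^sup>2 / (4 * x\<^sup>2 - 1))"
      by (simp add: Q_def x_def)
    ultimately show ?case by (simp only: x_def)
  qed simp
  moreover have "p = 1 / (y * q)" if "p * y * q = 1" for p y q :: real
    using that by (cases "y * q = 0") (auto simp: eq_divide_eq mult.assoc)
  ultimately have "(\<Prod>i=1..n. (odd_of i / (2 * real i))\<^sup>2)
      = 1 / ((2 * real n + 1) * (\<Prod>k=1..n. (4 * (real k)\<^sup>2) / (4 * (real k)\<^sup>2 - 1)))" (is "?P = 1 / (?y * ?Q)")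
    by blast
  then have "4 * real n * ?P = 4 * (real n / ?y) / ?Q" by simp
  then show ?thesis by (simp add: eigvec_def)
qed

lemma shifted_ratio_tendsto_1: "(\<lambda>n. (real n + c) / (real n + d)) \<longlonglongrightarrow> 1"
proof -
  have at_top: "filterlim (\<lambda>n. real n + d) at_top sequentially"
    using filterlim_tendsto_add_at_top[OF tendsto_const filterlim_real_sequentially, of d]
    by (simp add: add.commute)
  then have "(\<lambda>n. 1 + (c - d) / (real n + d)) \<longlonglongrightarrow> 1 + 0"
    by (intro tendsto_add tendsto_const tendsto_divide_0[OF tendsto_const] filterlim_at_top_imp_at_infinity)
  moreover have "eventually (\<lambda>n. 1 + (c - d) / (real n + d) = (real n + c) / (real n + d)) sequentially"
    using filterlim_at_top_dense[THEN iffD1, OF at_top, rule_format, of 0]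
    by eventually_elim (simp add: field_simps)
  ultimately show ?thesis by (simp add: Lim_transform_eventually)
qed

text \<open>Wallis settles \<open>k = 1\<close>; passing to \<open>k + 1\<close> multiplies by
  \<open>(n-k)/(n+k)\<close>, which tends to 1.\<close>

lemma eigvec_tendsto:
  assumes "1 \<le> k"
  shows "(\<lambda>n. eigvec n k) \<longlonglongrightarrow> 4 / pi"
  using assms
proof (induction k rule: dec_induct)
  case base
  have "real n / (2 * real n + 1) = 1 / 2 * ((real n + 0) / (real n + 1 / 2))" for n
    by (simp add: field_simps)
  then have "(\<lambda>n. real n / (2 * real n + 1)) \<longlonglongrightarrow> 1 / 2"
    using tendsto_mult[OF tendsto_const shifted_ratio_tendsto_1, of "1 / 2 :: real" 0 "1 / 2"] by simp
  then have "(\<lambda>n. eigvec n 1) \<longlonglongrightarrow> 4 * (1 / 2) / (pi / 2)"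
    unfolding eigvec_1_wallis by (intro tendsto_divide[OF tendsto_mult[OF tendsto_const] wallis]) auto
  then show ?case by simp
next
  case (step k)
  have "(\<lambda>n. (real n - real k) / (real n + real k)) \<longlonglongrightarrow> 1"
    using shifted_ratio_tendsto_1[of "- real k" "real k"] by simp
  from tendsto_mult[OF this step.IH]
  have "(\<lambda>n. (real n - real k) / (real n + real k) * eigvec n k) \<longlonglongrightarrow> 4 / pi" by simp
  also have "(\<lambda>n. (real n - real k) / (real n + real k) * eigvec n k) = (\<lambda>n. eigvec n (Suc k))"
  proof
    fix n
    show "(real n - real k) / (real n + real k) * eigvec n k = eigvec n (Suc k)"
      using eigvec_Suc_right[of k n] step by (simp add: field_simps)
  qed
  finally show ?case .
qed

text \<open>The factors \<open>(n-i)/(n+i)\<close> have modulus at most 1, so the convergent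
  sequence \<open>eigvec n 1\<close> dominates all \<open>k\<close>.\<close>

lemma eigvec_bounded: "\<exists>C. \<forall>n k. \<bar>eigvec n k\<bar> \<le> C"
proof -
  obtain C where C: "\<And>n. \<bar>eigvec n 1\<bar> \<le> C"
    using convergent_imp_Bseq[OF convergentI[OF eigvec_tendsto[of 1]]] by (auto simp: Bseq_def)
  have "\<bar>eigvec n k\<bar> \<le> \<bar>eigvec n 1\<bar>" for n k
  proof -
    have "\<bar>\<Prod>i=1..<k. (real n - real i) / (real n + real i)\<bar> \<le> 1"
      unfolding abs_prod by (intro prod_le_1) (auto simp: abs_if field_simps)
    then show ?thesis by (simp add: eigvec_def abs_mult mult_left_le)
  qed
  with C show ?thesis by (meson order_trans)
qed

text \<open>Dominated convergence for series, with the uniform eigenvector bound times the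
  coordinates as majorant.\<close>

lemma expands_tendsto:
  assumes "expands e f" and "summable (\<lambda>k. \<bar>e (Suc k)\<bar>)"
  shows "f \<longlonglongrightarrow> 4 / pi * (\<Sum>k. e (Suc k))"
proof -
  obtain C where C: "\<And>n k. \<bar>eigvec n k\<bar> \<le> C" using eigvec_bounded by blast
  have "(\<lambda>n. \<Sum>k. e (Suc k) * eigvec n (Suc k)) \<longlonglongrightarrow> (\<Sum>k. e (Suc k) * (4 / pi))"
  proof (rule tannerys_theorem[THEN conjunct2, THEN conjunct2])
    show "(\<lambda>n. e (Suc k) * eigvec n (Suc k)) \<longlonglongrightarrow> e (Suc k) * (4 / pi)" for k
      by (intro tendsto_intros eigvec_tendsto) simp
    show "eventually (\<lambda>(k, n). norm (e (Suc k) * eigvec n (Suc k)) \<le> \<bar>e (Suc k)\<bar> * C)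
           (sequentially \<times>\<^sub>F sequentially)"
      by (intro always_eventually) (auto simp: abs_mult intro!: mult_left_mono C)
    show "summable (\<lambda>k. \<bar>e (Suc k)\<bar> * C)" by (intro summable_mult2 assms)
  qed simp
  also have "(\<Sum>k. e (Suc k) * (4 / pi)) = 4 / pi * (\<Sum>k. e (Suc k))"
    using suminf_mult2[OF summable_rabs_cancel[OF assms(2)], of "4 / pi"] by (simp add: mult.commute)
  finally show ?thesis
  proof (rule Lim_transform_eventually)
    show "eventually (\<lambda>n. (\<Sum>k. e (Suc k) * eigvec n (Suc k)) = f n) sequentially"
      using eventually_ge_at_top[of 1]
    proof eventually_elim
      case (elim n)
      have "(\<Sum>k. e (Suc k) * eigvec n (Suc k)) = (\<Sum>k<n. e (Suc k) * eigvec n (Suc k))"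
        by (rule suminf_finite) (auto simp: eigvec_eq_0)
      also have "\<dots> = f n" using assms(1) elim by (simp add: expands_def sum.atLeast1_atMost_eq)
      finally show ?case .
    qed
  qed
qed

section \<open>Alternating sums with a fixed outermost index\<close>

lemma sign_vec_singleton [simp]: "sign_vec [s] = [(-1) ^ (s - 1)]"
  by (simp add: sign_vec_def)

lemma sign_vec_Cons [simp]: "ss \<noteq> [] \<Longrightarrow> sign_vec (s # ss) = (-1) ^ s # sign_vec ss"
  by (simp add: sign_vec_def)

lemma length_sign_vec: "ss \<noteq> [] \<Longrightarrow> length (sign_vec ss) = length ss"
  by (simp add: sign_vec_def)

text \<open>The contribution with outermost index exactly \<open>j\<close>, for arguments multiplied
  by \<open>b\<close>. Fixing that index gives functions of \<open>j\<close> on which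
  \<open>altop\<close> can act.\<close>

definition talt_lead :: "nat \<Rightarrow> nat list \<Rightarrow> nat \<Rightarrow> real" where
  "talt_lead b ss j = real_of_int (hd (sign_vec ss)) ^ j / odd_of j ^ (b * hd ss)
     * talt_trunc (j - 1) (zip (map (\<lambda>s. b * s) (tl ss)) (tl (sign_vec ss)))"

lemma talt_trunc_eq_sum_lead:
  assumes "ss \<noteq> []"
  shows "talt_trunc N (zip (map (\<lambda>s. b * s) ss) (sign_vec ss)) = (\<Sum>j=1..N. talt_lead b ss j)"
proof -
  obtain s ss' where ss: "ss = s # ss'" using assms by (cases ss) auto
  obtain t ts where ts: "sign_vec ss = t # ts"
    using length_sign_vec[OF assms] ss by (cases "sign_vec ss") auto
  show ?thesis unfolding talt_lead_def ts by (simp add: ss)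
qed

text \<open>First choice in \<open>L\<close>, the term \<open>f j\<close>: the leading part grows by
  one, and \<open>(-1)^j\<close> raises its sign exponent accordingly.\<close>

lemma talt_lead_Suc:
  assumes "ss \<noteq> []" "1 \<le> hd ss"
  shows "(-1) ^ j / odd_of j ^ b * talt_lead b ss j = talt_lead b (Suc (hd ss) # tl ss) j"
proof -
  obtain s ss' where ss: "ss = s # ss'" using assms by (cases ss) auto
  show ?thesis
  proof (cases "ss' = []")
    case True
    \<comment> \<open>Here the leading part is also the last, so its sign exponent is
      \<open>s - 1\<close>; \<open>s \<ge> 1\<close> prevents truncation.\<close>
    have "(-1) ^ j * ((-1) ^ (s - 1)) ^ j = (((-1) ^ s) ^ j :: real)"
      using assms ss by (cases s) (simp_all add: power_mult_distrib[symmetric])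
    then show ?thesis using True by (simp add: ss talt_lead_def power_add)
  next
    case False
    have "(-1) ^ j * ((-1) ^ s) ^ j = (((-1) ^ Suc s) ^ j :: real)"
      by (simp add: power_mult_distrib[symmetric])
    with False show ?thesis by (simp add: ss talt_lead_def power_add)
  qed
qed

text \<open>Second choice in \<open>L\<close>, the strict sum over \<open>k < j\<close>: a new
  leading part 1 appears, whose sign -1 supplies \<open>(-1)^j\<close>.\<close>

lemma talt_lead_Cons_1:
  assumes "ss \<noteq> []"
  shows "talt_lead b (1 # ss) j = (-1) ^ j / odd_of j ^ b * (\<Sum>k=1..<j. talt_lead b ss k)"
proof (cases j)
  case 0
  then show ?thesis using assms talt_trunc_eq_sum_lead[OF assms, of 0 b] by (simp add: talt_lead_def)
next
  case (Suc n)
  then have "{1..<j} = {1..n}" by auto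
  then show ?thesis using assms talt_trunc_eq_sum_lead[OF assms, of n b]
    by (simp add: talt_lead_def Suc)
qed

section \<open>Compositions and the iterates of \<open>L\<close>\<close>

definition all_compositions :: "nat \<Rightarrow> nat list set" where
  "all_compositions n = {ss. (\<forall>x\<in>set ss. 1 \<le> x) \<and> sum_list ss = n}"

lemma all_compositions_nonempty: "ss \<in> all_compositions n \<Longrightarrow> 1 \<le> n \<Longrightarrow> ss \<noteq> []"
  by (auto simp: all_compositions_def)

lemma all_compositions_1: "all_compositions 1 = {[1]}"
proof
  show "all_compositions 1 \<subseteq> {[1]}"
  proof
    fix ss assume ss: "ss \<in> all_compositions 1"
    then obtain s t where st: "ss = s # t" by (cases ss) (auto simp: all_compositions_def)
    with ss have "1 \<le> s" "s + sum_list t = 1" and t: "\<forall>x\<in>set t. 1 \<le> x"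
      by (auto simp: all_compositions_def)
    then have "s = 1" "sum_list t = 0" by linarith+
    with t have "t = []" by (cases t) auto
    with st \<open>s = 1\<close> show "ss \<in> {[1]}" by simp
  qed
qed (simp add: all_compositions_def)

text \<open>Splits by whether the leading part exceeds 1 or equals 1, matching the two choices in
  \<open>L\<close>.\<close>

lemma all_compositions_Suc:
  assumes "1 \<le> n"
  shows "all_compositions (Suc n) =
    (\<lambda>ss. Suc (hd ss) # tl ss) ` all_compositions n \<union> (#) 1 ` all_compositions n" (is "_ = ?A \<union> ?B")
proof
  show "all_compositions (Suc n) \<subseteq> ?A \<union> ?B"
  proof
    fix ss assume ss: "ss \<in> all_compositions (Suc n)"
    then obtain s t where st: "ss = s # t" by (cases ss) (auto simp: all_compositions_def)
    show "ss \<in> ?A \<union> ?B"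
    proof (cases "s = 1")
      case True
      with ss st have "t \<in> all_compositions n" by (auto simp: all_compositions_def)
      with st True show ?thesis by auto
    next
      case False
      with ss st have "(s - 1) # t \<in> all_compositions n" and "1 \<le> s"
        by (auto simp: all_compositions_def)
      then have "Suc (hd ((s - 1) # t)) # tl ((s - 1) # t) \<in> ?A" by blast
      with \<open>1 \<le> s\<close> st show ?thesis by simp
    qed
  qed
  show "?A \<union> ?B \<subseteq> all_compositions (Suc n)"
  proof (intro Un_least image_subsetI)
    fix ss assume "ss \<in> all_compositions n"
    moreover from this assms have "ss \<noteq> []" by (rule all_compositions_nonempty)
    ultimately show "Suc (hd ss) # tl ss \<in> all_compositions (Suc n)"
      by (cases ss) (auto simp: all_compositions_def)
  qed (auto simp: all_compositions_def)
qed

lemma finite_all_compositions: "1 \<le> n \<Longrightarrow> finite (all_compositions n)"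
proof (induction n rule: dec_induct)
  case base
  show ?case by (subst all_compositions_1) simp
qed (simp add: all_compositions_Suc)

lemma sum_all_compositions_Suc:
  fixes g :: "nat list \<Rightarrow> real"
  assumes "1 \<le> n"
  shows "(\<Sum>ss\<in>all_compositions (Suc n). g ss)
    = (\<Sum>ss\<in>all_compositions n. g (Suc (hd ss) # tl ss) + g (1 # ss))"
proof -
  have ne: "ss \<noteq> []" "1 \<le> hd ss" if "ss \<in> all_compositions n" for ss
    using all_compositions_nonempty[OF that assms] that by (auto simp: all_compositions_def)
  have "inj_on (\<lambda>ss. Suc (hd ss) # tl ss) (all_compositions n)"
  proof (rule inj_onI)
    fix ss ss' assume "ss \<in> all_compositions n" "ss' \<in> all_compositions n"
      and "Suc (hd ss) # tl ss = Suc (hd ss') # tl ss'"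
    then show "ss = ss'" using ne(1)[of ss] ne(1)[of ss'] by (cases ss; cases ss') auto
  qed
  moreover have "(\<lambda>ss. Suc (hd ss) # tl ss) ` all_compositions n \<inter> (#) 1 ` all_compositions n = {}"
    by (auto dest!: ne(2))
  ultimately show ?thesis
    unfolding all_compositions_Suc[OF assms]
    by (simp add: sum.union_disjoint finite_all_compositions[OF assms] sum.reindex sum.distrib)
qed

text \<open>Induction along the recursion for compositions. Each prepended part brings the factor 2
  of the strict sum, hence \<open>2 ^ (length ss - 1)\<close>.\<close>

lemma altop_funpow_eq_sum_lead:
  "(altop b ^^ m) (\<lambda>k. - (1 / odd_of k ^ b)) j
     = - (\<Sum>ss\<in>all_compositions (Suc m). 2 ^ (length ss - 1) * talt_lead b ss j)"
proof (induction m arbitrary: j)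
  case 0
  \<comment> \<open>The part 1 of \<open>[1]\<close> is the last one, with sign exponent
    \<open>1 - 1\<close>, so the start vector does not alternate.\<close>
  have "all_compositions (Suc 0) = {[1]}" using all_compositions_1 by simp
  then show ?case by (simp add: talt_lead_def)
next
  case (Suc m)
  let ?C = "all_compositions (Suc m)" and ?c = "\<lambda>ss. 2 ^ (length ss - 1) :: real"
  let ?q = "(-1) ^ j / odd_of j ^ b"
  have "(altop b ^^ Suc m) (\<lambda>k. - (1 / odd_of k ^ b)) j
      = ?q * (- (\<Sum>ss\<in>?C. ?c ss * talt_lead b ss j) + 2 * (\<Sum>k=1..<j. - (\<Sum>ss\<in>?C. ?c ss * talt_lead b ss k)))"
    by (simp add: altop_def Suc)
  also have "(\<Sum>k=1..<j. - (\<Sum>ss\<in>?C. ?c ss * talt_lead b ss k)) = - (\<Sum>ss\<in>?C. ?c ss * (\<Sum>k=1..<j. talt_lead b ss k))"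
    unfolding sum_negf sum_distrib_left by (subst sum.swap) simp
  also have "?q * (- (\<Sum>ss\<in>?C. ?c ss * talt_lead b ss j) + 2 * (- (\<Sum>ss\<in>?C. ?c ss * (\<Sum>k=1..<j. talt_lead b ss k))))
     = - (\<Sum>ss\<in>?C. ?c ss * (?q * talt_lead b ss j) + 2 * ?c ss * (?q * (\<Sum>k=1..<j. talt_lead b ss k)))"
    by (simp only: sum.distrib sum_distrib_left[symmetric] mult.left_commute[of _ ?q] mult.assoc)
      (simp add: algebra_simps sum_distrib_left[symmetric])
  also have "\<dots> = - (\<Sum>ss\<in>?C. ?c (Suc (hd ss) # tl ss) * talt_lead b (Suc (hd ss) # tl ss) j
                          + ?c (1 # ss) * talt_lead b (1 # ss) j)"
  proof (intro arg_cong[where f = uminus] sum.cong refl)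
    fix ss assume ss: "ss \<in> ?C"
    then have ne: "ss \<noteq> []" by (intro all_compositions_nonempty) auto
    with ss have h: "1 \<le> hd ss" by (auto simp: all_compositions_def)
    have "2 * ?c ss = ?c (1 # ss)" using ne by (cases ss) auto
    then show "?c ss * (?q * talt_lead b ss j) + 2 * ?c ss * (?q * (\<Sum>k=1..<j. talt_lead b ss k))
      = ?c (Suc (hd ss) # tl ss) * talt_lead b (Suc (hd ss) # tl ss) j + ?c (1 # ss) * talt_lead b (1 # ss) j"
      using talt_lead_Suc[OF ne h, of j b] talt_lead_Cons_1[OF ne, of b j] by simp
  qed
  also have "\<dots> = - (\<Sum>ss\<in>all_compositions (Suc (Suc m)). ?c ss * talt_lead b ss j)"
    by (subst sum_all_compositions_Suc) auto
  finally show ?case .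
qed

section \<open>Absolute convergence of the alternating values\<close>

lemma summable_inverse_odd_square: "summable (\<lambda>j. 1 / (odd_of (Suc j))\<^sup>2)"
proof (rule summable_comparison_test_ev)
  show "summable (\<lambda>j. inverse ((real (Suc j))\<^sup>2))"
    using inverse_power_summable[of 2, where ?'a = real] by (subst summable_Suc_iff) simp
  show "eventually (\<lambda>j. norm (1 / (odd_of (Suc j))\<^sup>2) \<le> inverse ((real (Suc j))\<^sup>2)) sequentially"
    by (intro always_eventually allI) (auto simp: divide_simps intro!: power_mono)
qed

lemma abs_talt_summand_le:
  assumes "2 \<le> s" "\<bar>\<sigma>\<bar> = 1" "\<bar>c\<bar> \<le> C" "1 \<le> j"
  shows "\<bar>real_of_int \<sigma> ^ j / odd_of j ^ s * c\<bar> \<le> C * (1 / (odd_of j)\<^sup>2)"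
proof -
  have j: "1 \<le> odd_of j" using assms by simp
  have "\<bar>real_of_int \<sigma>\<bar> = 1" using assms(2) by (metis of_int_1 of_int_abs)
  then have "\<bar>real_of_int \<sigma> ^ j / odd_of j ^ s * c\<bar> = \<bar>c\<bar> * (1 / odd_of j ^ s)"
    using j by (simp add: abs_mult power_abs)
  also have "\<dots> \<le> C * (1 / (odd_of j)\<^sup>2)"
    using j assms by (intro mult_mono divide_left_mono power_increasing) auto
  finally show ?thesis .
qed

text \<open>Each level multiplies the bound by the convergent sum of \<open>1/(2j-1)^2\<close>,
  uniformly in \<open>N\<close>.\<close>

lemma talt_trunc_bounded:
  assumes "\<forall>(s, \<sigma>)\<in>set l. 2 \<le> s \<and> \<bar>\<sigma>\<bar> = 1"
  shows "\<exists>C. \<forall>N. \<bar>talt_trunc N l\<bar> \<le> C"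
  using assms
proof (induction l)
  case (Cons p l)
  obtain s \<sigma> where p: "p = (s, \<sigma>)" by force
  from Cons obtain C where C: "\<And>N. \<bar>talt_trunc N l\<bar> \<le> C" by auto
  have "0 \<le> C" using C[of 0] by linarith
  have "\<bar>talt_trunc N (p # l)\<bar> \<le> C * (\<Sum>j. 1 / (odd_of (Suc j))\<^sup>2)" for N
  proof -
    have "\<bar>talt_trunc N (p # l)\<bar> \<le> (\<Sum>j=1..N. C * (1 / (odd_of j)\<^sup>2))"
      unfolding p talt_trunc.simps
      using Cons.prems p C by (intro order_trans[OF sum_abs] sum_mono abs_talt_summand_le) auto
    also have "\<dots> = C * (\<Sum>j<N. 1 / (odd_of (Suc j))\<^sup>2)"
      unfolding sum_distrib_left One_nat_def sum.atLeast1_atMost_eq ..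
    also have "\<dots> \<le> C * (\<Sum>j. 1 / (odd_of (Suc j))\<^sup>2)"
      using \<open>0 \<le> C\<close> by (intro mult_left_mono sum_le_suminf summable_inverse_odd_square) auto
    finally show ?thesis .
  qed
  then show ?case by blast
qed auto

lemma sign_vec_abs: "\<sigma> \<in> set (sign_vec ss) \<Longrightarrow> \<bar>\<sigma>\<bar> = 1"
  by (auto simp: sign_vec_def power_abs)

text \<open>\<open>b \<ge> 2\<close> makes every exponent at least 2, so bounded inner sums suffice
  whatever the signs.\<close>

lemma summable_talt_lead:
  assumes "ss \<noteq> []" "\<forall>x\<in>set ss. 1 \<le> x" "2 \<le> b"
  shows "summable (\<lambda>j. \<bar>talt_lead b ss (Suc j)\<bar>)"
proof -
  have sgn: "sign_vec ss \<noteq> []" using length_sign_vec[OF assms(1)] assms(1) by auto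
  have ge: "2 \<le> b * x" if "x \<in> set ss" for x
    using mult_le_mono[OF assms(3), of 1 x] assms(2) that by auto
  have "\<exists>C. \<forall>N. \<bar>talt_trunc N (zip (map (\<lambda>s. b * s) (tl ss)) (tl (sign_vec ss)))\<bar> \<le> C"
  proof (intro talt_trunc_bounded ballI, clarify)
    fix s \<sigma> assume z: "(s, \<sigma>) \<in> set (zip (map (\<lambda>s. b * s) (tl ss)) (tl (sign_vec ss)))"
    from set_zip_leftD[OF z] have "2 \<le> s"
      using ge list.set_sel(2)[OF assms(1)] by auto
    moreover have "\<bar>\<sigma>\<bar> = 1"
      by (rule sign_vec_abs[OF list.set_sel(2)[OF sgn set_zip_rightD[OF z]]])
    ultimately show "2 \<le> s \<and> \<bar>\<sigma>\<bar> = 1" ..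
  qed
  then obtain C where C: "\<And>N. \<bar>talt_trunc N (zip (map (\<lambda>s. b * s) (tl ss)) (tl (sign_vec ss)))\<bar> \<le> C"
    by blast
  show ?thesis
  proof (rule summable_comparison_test_ev)
    show "summable (\<lambda>j. C * (1 / (odd_of (Suc j))\<^sup>2))"
      by (intro summable_mult summable_inverse_odd_square)
    show "eventually (\<lambda>j. norm \<bar>talt_lead b ss (Suc j)\<bar> \<le> C * (1 / (odd_of (Suc j))\<^sup>2)) sequentially"
      unfolding talt_lead_def real_norm_def abs_idempotent
      using assms(1) ge C sign_vec_abs[OF list.set_sel(1)[OF sgn]]
      by (intro always_eventually allI abs_talt_summand_le) auto
  qed
qed

text \<open>\<open>talt\<close> is defined by \<open>lim\<close>, which is informative only under
  convergence; absolute summability provides it.\<close>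

lemma talt_eq_suminf_lead:
  assumes "ss \<noteq> []" "\<forall>x\<in>set ss. 1 \<le> x" "2 \<le> b"
  shows "talt (map (\<lambda>s. b * s) ss) (sign_vec ss) = (\<Sum>j. talt_lead b ss (Suc j))"
proof -
  have "(\<lambda>N. \<Sum>j<N. talt_lead b ss (Suc j)) \<longlonglongrightarrow> (\<Sum>j. talt_lead b ss (Suc j))"
    by (rule summable_LIMSEQ[OF summable_rabs_cancel[OF summable_talt_lead[OF assms]]])
  then show ?thesis
    unfolding talt_def talt_trunc_eq_sum_lead[OF assms(1)] One_nat_def sum.atLeast1_atMost_eq by (rule limI)
qed

section \<open>Regrouping by length and the final identity\<close>

lemma sum_all_compositions_by_length:
  fixes g :: "nat list \<Rightarrow> real"
  assumes "1 \<le> n"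
  shows "(\<Sum>ss\<in>all_compositions n. g ss) = (\<Sum>r=1..n. \<Sum>ss\<in>compositions n r. g ss)"
proof -
  have len: "length ss \<le> sum_list ss" if "\<forall>x\<in>set ss. 1 \<le> x" for ss :: "nat list"
    using that by (induction ss) auto
  have "length ` all_compositions n \<subseteq> {1..n}"
    using len all_compositions_nonempty[OF _ assms] by (fastforce simp: all_compositions_def Suc_le_eq)
  from sum.group[OF finite_all_compositions[OF assms] _ this, of g]
  have "(\<Sum>ss\<in>all_compositions n. g ss) = (\<Sum>r=1..n. \<Sum>ss\<in>{ss \<in> all_compositions n. length ss = r}. g ss)"
    by simp
  moreover have "{ss \<in> all_compositions n. length ss = r} = compositions n r" for r
    by (auto simp: all_compositions_def compositions_def)
  ultimately show ?thesis by simp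
qed

theorem theorem4p8:
  fixes d a :: nat
  assumes "1 \<le> d"
  shows "tstar (concat (replicate (d - 1) (replicate a 2 @ [3] @ replicate a 2 @ [1]))
                 @ replicate a 2 @ [3] @ replicate a 2)
       = - (2 / pi) * (\<Sum>r = 1..2 * d. 2 ^ r *
            (\<Sum>ss \<in> compositions (2 * d) r.
               talt (map (\<lambda>s. (2 * a + 2) * s) ss) (sign_vec ss)))"
proof -
  define b where "b = 2 * a + 2"
  define e where "e = (altop b ^^ (2 * (d - 1) + 1)) (\<lambda>k. - (1 / odd_of k ^ b))"
  let ?C = "all_compositions (2 * d)" and ?c = "\<lambda>ss. 2 ^ (length ss - 1) :: real"
  \<comment> \<open>The \<open>2d-1\<close> applications of \<open>L\<close> yield compositions of
    \<open>2d\<close>.\<close>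
  have d: "Suc (2 * (d - 1) + 1) = 2 * d" using assms by simp
  have e: "e = (\<lambda>j. - (\<Sum>ss\<in>?C. ?c ss * talt_lead b ss j))"
    unfolding e_def altop_funpow_eq_sum_lead d ..
  have C: "ss \<noteq> []" "\<forall>x\<in>set ss. 1 \<le> x" if "ss \<in> ?C" for ss
    using all_compositions_nonempty[OF that] that assms by (auto simp: all_compositions_def)
  have b: "2 \<le> b" by (simp add: b_def)
  have sm: "summable (\<lambda>j. \<bar>talt_lead b ss (Suc j)\<bar>)" if "ss \<in> ?C" for ss
    using summable_talt_lead[OF C[OF that] b] .
  have "summable (\<lambda>j. \<bar>e (Suc j)\<bar>)"
  proof (rule summable_comparison_test_ev)
    show "summable (\<lambda>j. \<Sum>ss\<in>?C. ?c ss * \<bar>talt_lead b ss (Suc j)\<bar>)"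
      by (intro summable_sum summable_mult sm)
    show "eventually (\<lambda>j. norm \<bar>e (Suc j)\<bar> \<le> (\<Sum>ss\<in>?C. ?c ss * \<bar>talt_lead b ss (Suc j)\<bar>)) sequentially"
      unfolding e by (intro always_eventually allI) (auto intro!: order_trans[OF sum_abs] sum_mono simp: abs_mult)
  qed
  with expands_tstar_blocks[where a = a and m = "d - 1", folded b_def, folded e_def]
  have "tstar (concat (replicate (d - 1) (replicate a 2 @ [3] @ replicate a 2 @ [1]))
                 @ replicate a 2 @ [3] @ replicate a 2) = 4 / pi * (\<Sum>j. e (Suc j))"
    unfolding tstar_def by (intro limI expands_tendsto)
  also have "(\<Sum>j. e (Suc j)) = - (\<Sum>ss\<in>?C. ?c ss * talt (map (\<lambda>s. b * s) ss) (sign_vec ss))"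
  proof -
    have "(\<lambda>j. \<Sum>ss\<in>?C. ?c ss * talt_lead b ss (Suc j)) sums (\<Sum>ss\<in>?C. ?c ss * (\<Sum>j. talt_lead b ss (Suc j)))"
      by (intro sums_sum sums_mult summable_sums summable_rabs_cancel[OF sm])
    then have "(\<Sum>j. e (Suc j)) = - (\<Sum>ss\<in>?C. ?c ss * (\<Sum>j. talt_lead b ss (Suc j)))"
      unfolding e by (intro sums_unique[symmetric] sums_minus)
    also have "(\<Sum>ss\<in>?C. ?c ss * (\<Sum>j. talt_lead b ss (Suc j)))
        = (\<Sum>ss\<in>?C. ?c ss * talt (map (\<lambda>s. b * s) ss) (sign_vec ss))"
      by (intro sum.cong refl) (simp add: talt_eq_suminf_lead[OF C b])
    finally show ?thesis .
  qed
  \<comment> \<open>A factor 2 moves from \<open>4/pi\<close> into the weights, turning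
    \<open>2 ^ (r-1)\<close> into \<open>2 ^ r\<close>.\<close>
  also have "4 / pi * - (\<Sum>ss\<in>?C. ?c ss * talt (map (\<lambda>s. b * s) ss) (sign_vec ss))
      = - (2 / pi) * (\<Sum>ss\<in>?C. 2 ^ length ss * talt (map (\<lambda>s. b * s) ss) (sign_vec ss))"
  proof -
    have "(\<Sum>ss\<in>?C. 2 ^ length ss * talt (map (\<lambda>s. b * s) ss) (sign_vec ss))
       = (\<Sum>ss\<in>?C. 2 * (?c ss * talt (map (\<lambda>s. b * s) ss) (sign_vec ss)))"
    proof (intro sum.cong refl)
      fix ss assume "ss \<in> ?C"
      then have "2 ^ length ss = 2 * ?c ss" using C(1) by (cases ss) auto
      then show "2 ^ length ss * talt (map (\<lambda>s. b * s) ss) (sign_vec ss)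
        = 2 * (?c ss * talt (map (\<lambda>s. b * s) ss) (sign_vec ss))" by simp
    qed
    then show ?thesis by (simp add: sum_distrib_left[symmetric])
  qed
  also have "(\<Sum>ss\<in>?C. 2 ^ length ss * talt (map (\<lambda>s. b * s) ss) (sign_vec ss))
     = (\<Sum>r=1..2 * d. 2 ^ r * (\<Sum>ss\<in>compositions (2 * d) r. talt (map (\<lambda>s. b * s) ss) (sign_vec ss)))"
  proof (subst sum_all_compositions_by_length)
    show "1 \<le> 2 * d" using assms by simp
    show "(\<Sum>r=1..2 * d. \<Sum>ss\<in>compositions (2 * d) r. 2 ^ length ss * talt (map (\<lambda>s. b * s) ss) (sign_vec ss))
       = (\<Sum>r=1..2 * d. 2 ^ r * (\<Sum>ss\<in>compositions (2 * d) r. talt (map (\<lambda>s. b * s) ss) (sign_vec ss)))"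
      unfolding sum_distrib_left by (intro sum.cong refl) (simp add: compositions_def)
  qed
  finally show ?thesis unfolding b_def .
qed

end
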